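(* The Cantor ternary set $K\subset\mathbb{R}$ has Lebesgue measure zero: $\lambda(K)=0$, where $\lambda$ denotes Lebesgue measure on $\mathbb{R}$.
   Context: Cantor ternary set: $K_0=[0,1]$; for each $n\ge 0$, $K_n$ is a union of $2^n$ disjoint closed intervals, and $K_{n+1}$ is obtained from $K_n$ by removing from each of these intervals its open middle third (so $K_1=[0,\frac13]\cup[\frac23,1]$, etc.). The Cantor ternary set is $K=\bigcap_{n\in\mathbb{N}}K_n$. *)

theory Defs
  imports "HOL-Analysis.Analysis"
begin

text \<open>
  The intervals of stage \<open>n\<close> are recorded by their endpoints: a pair \<open>(a, b)\<close> stands for \<open>{a..b}\<close>,
  whose open middle third is \<open>{a + (b - a) / 3<..<b - (b - a) / 3}\<close>.
\<close>

primrec cantor_intervals :: "nat \<Rightarrow> (real \<times> real) set" where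
  "cantor_intervals 0 = {(0, 1)}"
| "cantor_intervals (Suc n) =
     (\<Union>(a, b)\<in>cantor_intervals n. {(a, a + (b - a) / 3), (b - (b - a) / 3, b)})"

primrec cantor_stage :: "nat \<Rightarrow> real set" where
  "cantor_stage 0 = {0..1}"
| "cantor_stage (Suc n) =
     cantor_stage n - (\<Union>(a, b)\<in>cantor_intervals n. {a + (b - a) / 3<..<b - (b - a) / 3})"

definition cantor_set :: "real set" where
  "cantor_set = (\<Inter>n. cantor_stage n)"

text \<open>
  The next lemmas tie the two recursions together: stage \<open>n\<close> is the union of the recorded
  intervals, which are \<open>2 ^ n\<close> in number, nondegenerate and pairwise disjoint.
\<close>

lemma cantor_intervals_less: "(a, b) \<in> cantor_intervals n \<Longrightarrow> a < b"
proof (induction n arbitrary: a b)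
  case 0
  then show ?case by simp
next
  case (Suc n)
  from Suc.prems obtain c d where cd: "(c, d) \<in> cantor_intervals n"
    and ab: "(a, b) = (c, c + (d - c) / 3) \<or> (a, b) = (d - (d - c) / 3, d)"
    by auto
  from Suc.IH[OF cd] ab show ?case by auto
qed

lemma cantor_intervals_separated:
  assumes "(a, b) \<in> cantor_intervals n" "(c, d) \<in> cantor_intervals n" "(a, b) \<noteq> (c, d)"
  shows "b < c \<or> d < a"
  using assms
proof (induction n arbitrary: a b c d)
  case 0
  then show ?case by simp
next
  case (Suc n)
  from Suc.prems(1) obtain a' b' where 1: "(a', b') \<in> cantor_intervals n"
    and ab: "(a, b) = (a', a' + (b' - a') / 3) \<or> (a, b) = (b' - (b' - a') / 3, b')"
    by auto
  from Suc.prems(2) obtain c' d' where 2: "(c', d') \<in> cantor_intervals n"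
    and cd: "(c, d) = (c', c' + (d' - c') / 3) \<or> (c, d) = (d' - (d' - c') / 3, d')"
    by auto
  note less = cantor_intervals_less[OF 1] cantor_intervals_less[OF 2]
  show ?case
  proof (cases "(a', b') = (c', d')")
    case True
    with ab cd less Suc.prems(3) show ?thesis by (auto simp: field_simps)
  next
    case False
    from Suc.IH[OF 1 2 False] ab cd less show ?thesis by (auto simp: field_simps)
  qed
qed

lemma cantor_intervals_disjoint:
  "disjoint_family_on (\<lambda>(a, b). {a..b}) (cantor_intervals n)"
  unfolding disjoint_family_on_def
proof (intro ballI impI)
  fix p q
  assume pq: "p \<in> cantor_intervals n" "q \<in> cantor_intervals n" "p \<noteq> q"
  obtain a b c d where "p = (a, b)" "q = (c, d)" by (metis surj_pair)
  with pq cantor_intervals_separated[of a b n c d]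
  show "(case p of (a, b) \<Rightarrow> {a..b}) \<inter> (case q of (a, b) \<Rightarrow> {a..b}) = {}"
    by auto
qed

lemma finite_cantor_intervals: "finite (cantor_intervals n)"
  by (induction n) auto

lemma card_cantor_intervals: "card (cantor_intervals n) = 2 ^ n"
proof (induction n)
  case 0
  then show ?case by simp
next
  case (Suc n)
  let ?F = "\<lambda>(a, b). {(a, a + (b - a) / 3), (b - (b - a) / 3, b :: real)}"
  have "card (\<Union>p\<in>cantor_intervals n. ?F p) = (\<Sum>p\<in>cantor_intervals n. card (?F p))"
  proof (rule card_UN_disjoint)
    show "\<forall>p\<in>cantor_intervals n. \<forall>q\<in>cantor_intervals n. p \<noteq> q \<longrightarrow> ?F p \<inter> ?F q = {}"
    proof (intro ballI impI)
      fix p q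
      assume pq: "p \<in> cantor_intervals n" "q \<in> cantor_intervals n" "p \<noteq> q"
      obtain a b c d where eq: "p = (a, b)" "q = (c, d)" by (metis surj_pair)
      with pq have "a < b" "c < d" "b < c \<or> d < a"
        using cantor_intervals_less cantor_intervals_separated by blast+
      then have "fst r < fst s \<or> fst s < fst r" if "r \<in> ?F p" "s \<in> ?F q" for r s
        using that unfolding eq by (auto simp: field_simps)
      then show "?F p \<inter> ?F q = {}" by blast
    qed
  qed (auto simp: finite_cantor_intervals)
  also have "\<dots> = (\<Sum>p\<in>cantor_intervals n. 2)"
  proof (rule sum.cong)
    fix p assume "p \<in> cantor_intervals n"
    then show "card (?F p) = 2"
      using cantor_intervals_less[of "fst p" "snd p" n] by (cases p) (auto simp: card_insert_if field_simps)
  qed simp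
  also have "\<dots> = 2 ^ Suc n" using Suc.IH by simp
  finally show ?case by simp
qed

lemma cantor_stage_eq: "cantor_stage n = (\<Union>(a, b)\<in>cantor_intervals n. {a..b})"
proof (induction n)
  case 0
  then show ?case by simp
next
  case (Suc n)
  show ?case
  proof (intro equalityI subsetI)
    fix x
    assume x: "x \<in> cantor_stage (Suc n)"
    with Suc.IH obtain a b where ab: "(a, b) \<in> cantor_intervals n" "x \<in> {a..b}" by auto
    with x have "x \<notin> {a + (b - a) / 3<..<b - (b - a) / 3}" by auto
    with ab(2) have "x \<in> {a..a + (b - a) / 3} \<union> {b - (b - a) / 3..b}" by auto
    with ab(1) show "x \<in> (\<Union>(a, b)\<in>cantor_intervals (Suc n). {a..b})" by fastforce
  next
    fix x
    assume "x \<in> (\<Union>(a, b)\<in>cantor_intervals (Suc n). {a..b})"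
    then obtain a b where ab: "(a, b) \<in> cantor_intervals n"
      and "x \<in> {a..a + (b - a) / 3} \<union> {b - (b - a) / 3..b}" by auto
    with cantor_intervals_less[OF ab]
    have x: "x \<in> {a..b}" "x \<notin> {a + (b - a) / 3<..<b - (b - a) / 3}" by (auto simp: field_simps)
    have "x \<notin> {c + (d - c) / 3<..<d - (d - c) / 3}" if cd: "(c, d) \<in> cantor_intervals n" for c d
    proof (cases "(a, b) = (c, d)")
      case True
      with x(2) show ?thesis by auto
    next
      case False
      with cantor_intervals_separated[OF ab cd] cantor_intervals_less[OF cd] x(1)
      show ?thesis by (auto simp: field_simps)
    qed
    moreover have "x \<in> cantor_stage n" using Suc.IH ab x(1) by fastforce
    ultimately show "x \<in> cantor_stage (Suc n)" by auto
  qed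
qed

end

theory Submission
  imports Defs
begin

text \<open>
  Every interval of stage \<open>n\<close> has length \<open>(1 / 3) ^ n\<close>, because removing an open middle third leaves
  two pieces of a third of the length. The \<open>2 ^ n\<close> intervals together therefore have measure at most
  \<open>(2 / 3) ^ n\<close>. The Cantor set lies in every stage, so it is covered by measurable sets of
  arbitrarily small measure and is a null set; its measurability follows from the
  completeness of Lebesgue measure.
\<close>

lemma cantor_intervals_length:
  "(a, b) \<in> cantor_intervals n \<Longrightarrow> b - a = (1 / 3) ^ n"
proof (induction n arbitrary: a b)
  case 0
  then show ?case by simp
next
  case (Suc n)
  from Suc.prems obtain c d where cd: "(c, d) \<in> cantor_intervals n"
    and ab: "(a, b) = (c, c + (d - c) / 3) \<or> (a, b) = (d - (d - c) / 3, d)"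
    by auto
  from ab have "b - a = (d - c) / 3" by auto
  also have "\<dots> = (1 / 3) ^ Suc n" by (simp add: Suc.IH[OF cd])
  finally show ?case .
qed

lemma lmeasurable_cantor_stage: "cantor_stage n \<in> lmeasurable"
  unfolding cantor_stage_eq
  by (intro fmeasurable.finite_UN finite_cantor_intervals) auto

lemma measure_cantor_stage_le: "measure lebesgue (cantor_stage n) \<le> (2 / 3) ^ n"
proof -
  have "measure lebesgue (cantor_stage n)
      \<le> (\<Sum>p\<in>cantor_intervals n. measure lebesgue (case p of (a, b) \<Rightarrow> {a..b}))"
    unfolding cantor_stage_eq
    by (intro measure_UNION_le finite_cantor_intervals) auto
  also have "\<dots> = (\<Sum>p\<in>cantor_intervals n. (1 / 3) ^ n)"
  proof (intro sum.cong refl)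
    fix p assume "p \<in> cantor_intervals n"
    then show "measure lebesgue (case p of (a, b) \<Rightarrow> {a..b}) = (1 / 3) ^ n"
      using cantor_intervals_less[of "fst p" "snd p" n]
        cantor_intervals_length[of "fst p" "snd p" n]
      by (cases p) auto
  qed
  also have "\<dots> = (2 / 3) ^ n"
    by (simp add: card_cantor_intervals power_divide)
  finally show ?thesis .
qed

lemma negligible_cantor_set: "negligible cantor_set"
  unfolding negligible_outer
proof (intro allI impI)
  fix e :: real
  assume "e > 0"
  then obtain n where "(2 / 3 :: real) ^ n < e"
    using real_arch_pow_inv[of e "2 / 3"] by auto
  then have "measure lebesgue (cantor_stage n) < e"
    using measure_cantor_stage_le[of n] by linarith
  moreover have "cantor_set \<subseteq> cantor_stage n"
    unfolding cantor_set_def by blast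
  ultimately show "\<exists>T. cantor_set \<subseteq> T \<and> T \<in> lmeasurable \<and> measure lebesgue T < e"
    using lmeasurable_cantor_stage by blast
qed

theorem mainTheorem2:
  shows "cantor_set \<in> sets lebesgue \<and> emeasure lebesgue cantor_set = 0"
  using negligible_cantor_set by (auto simp: negligible_iff_null_sets null_sets_def)

end
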